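(* Let $n>3$ be odd and $m<n$ a positive integer with $\gcd(m,n)=\gcd(m-1,n)=1$. For every positive divisor $t$ of $n$ and all $i,j\in\{1,\dots,t\}$, the neutrosophic subloops $\langle H_i(t)\cup I\rangle$ and $\langle H_j(t)\cup I\rangle$ of $\langle L_n(m)\cup I\rangle$ are isomorphic.
   Context: For $n>3$ odd and $m<n$ a positive integer with $\gcd(m,n)=\gcd(m-1,n)=1$, the loop $L_n(m)$ is the set $\{e,1,2,\dots,n\}$ with operation: $e\cdot i=i\cdot e=i$ for all $i$; $i\cdot i=e$ for all $i$; and for $i,j\in\{1,\dots,n\}$, $i\neq j$, $i\cdot j$ is the element $s\in\{1,\dots,n\}$ with $s\equiv mj-(m-1)i \pmod n$. The neutrosophic loop $\langle L_n(m)\cup I\rangle$ is the set $\{e,1,\dots,n,eI,1I,\dots,nI\}$ of $2(n+1)$ distinct symbols, with the product of $L_n(m)$ on $\{e,1,\dots,n\}$ and $x\cdot(yI)=(xI)\cdot y=(xI)\cdot(yI)=(x\cdot y)I$ for $x,y\in L_n(m)$. For a positive divisor $t$ of $n$, $k=n/t$ and $1\le i\le t$, $\langle H_i(t)\cup I\rangle=\{e,i,i+t,i+2t,\dots,i+(k-1)t,\ eI,iI,(i+t)I,(i+2t)I,\dots,(i+(k-1)t)I\}$. An isomorphism is a bijection $f$ preserving products and leaving $I$ invariant, i.e. mapping non-$I$ elements to non-$I$ elements with $f(xI)=f(x)I$. *)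

theory Defs
  imports "HOL-Algebra.Group" "HOL-Number_Theory.Cong"
begin

(* The record 'a monoid serves only as a carrier with a product and a distinguished
   element; associativity is never assumed. *)
locale loop =
  fixes G (structure)
  assumes mult_closed: "\<lbrakk>x \<in> carrier G; y \<in> carrier G\<rbrakk> \<Longrightarrow> x \<otimes> y \<in> carrier G"
    and one_in_carrier: "\<one> \<in> carrier G"
    and left_one: "x \<in> carrier G \<Longrightarrow> \<one> \<otimes> x = x"
    and right_one: "x \<in> carrier G \<Longrightarrow> x \<otimes> \<one> = x"
    and left_division: "\<lbrakk>a \<in> carrier G; b \<in> carrier G\<rbrakk> \<Longrightarrow> \<exists>!x. x \<in> carrier G \<and> a \<otimes> x = b"
    and right_division: "\<lbrakk>a \<in> carrier G; b \<in> carrier G\<rbrakk> \<Longrightarrow> \<exists>!y. y \<in> carrier G \<and> y \<otimes> a = b"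


datatype loop_elem = Ident | Pt nat

fun L_mult :: "nat \<Rightarrow> nat \<Rightarrow> loop_elem \<Rightarrow> loop_elem \<Rightarrow> loop_elem" where
  "L_mult n m Ident y = y"
| "L_mult n m (Pt i) Ident = Pt i"
| "L_mult n m (Pt i) (Pt j) =
     (if i = j then Ident
      else Pt (THE s. s \<in> {1..n} \<and> [int s = int m * int j - (int m - 1) * int i] (mod int n)))"

definition L :: "nat \<Rightarrow> nat \<Rightarrow> loop_elem monoid" where
  "L n m = \<lparr>carrier = insert Ident (Pt ` {1..n}), monoid.mult = L_mult n m, one = Ident\<rparr>"


(* Plain x is the symbol x itself and TimesI x is the symbol xI. *)
datatype 'a neutro = Plain 'a | TimesI 'a

definition adjoin_I :: "'a set \<Rightarrow> 'a neutro set" where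
  "adjoin_I A = Plain ` A \<union> TimesI ` A"

fun neutro_mult :: "('a, 'b) monoid_scheme \<Rightarrow> 'a neutro \<Rightarrow> 'a neutro \<Rightarrow> 'a neutro" where
  "neutro_mult G (Plain x) (Plain y) = Plain (x \<otimes>\<^bsub>G\<^esub> y)"
| "neutro_mult G (Plain x) (TimesI y) = TimesI (x \<otimes>\<^bsub>G\<^esub> y)"
| "neutro_mult G (TimesI x) (Plain y) = TimesI (x \<otimes>\<^bsub>G\<^esub> y)"
| "neutro_mult G (TimesI x) (TimesI y) = TimesI (x \<otimes>\<^bsub>G\<^esub> y)"

definition neutrosophic_loop :: "('a, 'b) monoid_scheme \<Rightarrow> 'a neutro monoid" where
  "neutrosophic_loop G =
     \<lparr>carrier = adjoin_I (carrier G), monoid.mult = neutro_mult G, one = Plain \<one>\<^bsub>G\<^esub>\<rparr>"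

(* A neutrosophic loop is in general not a loop: (eI) \<otimes> x = y has no solution x for plain y.
   A neutrosophic subloop is thus the neutrosophic loop generated by a subloop P and I;
   P is not required to be proper. *)
definition neutrosophic_subloop :: "'a neutro set \<Rightarrow> ('a, 'b) monoid_scheme \<Rightarrow> bool" where
  "neutrosophic_subloop S G \<longleftrightarrow>
     (\<exists>P \<subseteq> carrier G. loop (G\<lparr>carrier := P\<rparr>) \<and> S = adjoin_I P)"

definition neutrosophic_iso ::
  "('a neutro, 'c) monoid_scheme \<Rightarrow> ('b neutro, 'd) monoid_scheme \<Rightarrow> ('a neutro \<Rightarrow> 'b neutro) set"
  where
  "neutrosophic_iso K K' =
     {f \<in> iso K K'. \<forall>x. Plain x \<in> carrier K \<longrightarrow> (\<exists>y. f (Plain x) = Plain y \<and> f (TimesI x) = TimesI y)}"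


definition H :: "nat \<Rightarrow> nat \<Rightarrow> nat \<Rightarrow> loop_elem set" where
  "H n t i = insert Ident ((\<lambda>r. Pt (i + r * t)) ` {0..<n div t})"

end

theory Submission
  imports Defs
begin

text \<open>
  The points of \<^term>\<open>H n t i\<close> are exactly the \<open>s \<in> {1..n}\<close> congruent to \<open>i\<close> modulo \<open>t\<close>
  (lemma \<open>Pt_in_H_iff\<close>). The product \<open>m * b - (m - 1) * a\<close> of two points is an affine
  combination of them: its coefficients add up to 1. Two consequences give the theorem.
  First, a product of two points congruent to \<open>i\<close> modulo \<open>t\<close> is again congruent to \<open>i\<close>, so
  \<^term>\<open>H n t i\<close> is closed under the product. Second, affine combinations commute with
  translations, so \<open>s \<mapsto> s + (j - i)\<close> preserves products; it carries \<^term>\<open>H n t i\<close> onto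
  \<^term>\<open>H n t j\<close>.

  Division comes from counting. The coefficients \<open>m\<close> and \<open>m - 1\<close> are units modulo \<open>n\<close>, hence
  both translations by a fixed element are injective, and an injective self-map of a finite set is
  a bijection (lemma \<open>finite_cancellative_loop\<close>). Finally, an isomorphism of loops
  extends to the symbols \<open>xI\<close> through the functor \<^term>\<open>map_neutro\<close>
  (lemma \<open>map_neutro_neutrosophic_iso\<close>).
\<close>


section \<open>Finite cancellative structures and neutrosophic extensions\<close>

lemma finite_cancellative_loop:
  fixes G (structure)
  assumes fin: "finite (carrier G)"
    and closed: "\<And>x y. \<lbrakk>x \<in> carrier G; y \<in> carrier G\<rbrakk> \<Longrightarrow> x \<otimes> y \<in> carrier G"
    and one: "\<one> \<in> carrier G"
    and "\<And>x. x \<in> carrier G \<Longrightarrow> \<one> \<otimes> x = x"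
    and "\<And>x. x \<in> carrier G \<Longrightarrow> x \<otimes> \<one> = x"
    and injl: "\<And>a. a \<in> carrier G \<Longrightarrow> inj_on (\<lambda>x. a \<otimes> x) (carrier G)"
    and injr: "\<And>a. a \<in> carrier G \<Longrightarrow> inj_on (\<lambda>x. x \<otimes> a) (carrier G)"
  shows "loop G"
proof -
  have solve: "\<exists>!x. x \<in> carrier G \<and> h x = b"
    if "inj_on h (carrier G)" "h ` carrier G \<subseteq> carrier G" "b \<in> carrier G" for h b
  proof -
    have "h ` carrier G = carrier G"
      using endo_inj_surj[OF fin] that by blast
    then show ?thesis
      using that by (metis (no_types, lifting) imageE inj_onD)
  qed
  show ?thesis
  proof
    fix a b assume ab: "a \<in> carrier G" "b \<in> carrier G"
    show "\<exists>!x. x \<in> carrier G \<and> a \<otimes> x = b"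
      by (rule solve) (use ab injl closed in auto)
    show "\<exists>!y. y \<in> carrier G \<and> y \<otimes> a = b"
      by (rule solve) (use ab injr closed in auto)
  qed (use assms in auto)
qed

lemma neutro_mult_map:
  assumes "f \<in> hom G G'" "u \<in> adjoin_I (carrier G)" "v \<in> adjoin_I (carrier G)"
  shows "map_neutro f (neutro_mult G u v) = neutro_mult G' (map_neutro f u) (map_neutro f v)"
  using assms by (auto simp: adjoin_I_def hom_mult)

lemma map_neutro_neutrosophic_iso:
  assumes "f \<in> iso G G'"
  shows "map_neutro f \<in> neutrosophic_iso (neutrosophic_loop G) (neutrosophic_loop G')"
proof -
  have hom: "f \<in> hom G G'" and bij: "bij_betw f (carrier G) (carrier G')"
    using assms by (auto simp: iso_def)
  have image: "map_neutro f ` adjoin_I (carrier G) = adjoin_I (carrier G')"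
    unfolding bij_betw_imp_surj_on[OF bij, symmetric]
    by (simp add: adjoin_I_def image_Un image_image)
  have "inj_on (map_neutro f) (adjoin_I (carrier G))"
    by (rule inj_onI) (auto simp: adjoin_I_def dest: inj_onD[OF bij_betw_imp_inj_on[OF bij]])
  then have map_bij: "bij_betw (map_neutro f) (adjoin_I (carrier G)) (adjoin_I (carrier G'))"
    using image by (simp add: bij_betw_def)
  have "map_neutro f \<in> iso (neutrosophic_loop G) (neutrosophic_loop G')"
  proof (rule isoI)
    show "map_neutro f \<in> hom (neutrosophic_loop G) (neutrosophic_loop G')"
      using neutro_mult_map[OF hom] bij_betwE[OF map_bij]
      by (intro homI) (simp_all add: neutrosophic_loop_def)
    show "bij_betw (map_neutro f) (carrier (neutrosophic_loop G)) (carrier (neutrosophic_loop G'))"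
      using map_bij by (simp add: neutrosophic_loop_def)
  qed
  then show ?thesis
    by (simp add: neutrosophic_iso_def)
qed

lemma neutro_mult_carrier_update: "neutro_mult (G\<lparr>carrier := A\<rparr>) = neutro_mult G"
proof (intro ext)
  fix u v
  show "neutro_mult (G\<lparr>carrier := A\<rparr>) u v = neutro_mult G u v"
    by (cases u; cases v) simp_all
qed

lemma neutrosophic_loop_carrier_update:
  "neutrosophic_loop (G\<lparr>carrier := A\<rparr>) = (neutrosophic_loop G)\<lparr>carrier := adjoin_I A\<rparr>"
  by (simp add: neutrosophic_loop_def neutro_mult_carrier_update)


section \<open>The product of two points\<close>

definition point_mult :: "nat \<Rightarrow> nat \<Rightarrow> nat \<Rightarrow> nat \<Rightarrow> nat" where
  "point_mult n m a b =
     (THE s. s \<in> {1..n} \<and> [int s = int m * int b - (int m - 1) * int a] (mod int n))"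

lemma L_mult_Pt: "L_mult n m (Pt a) (Pt b) = (if a = b then Ident else Pt (point_mult n m a b))"
  by (simp add: point_mult_def)

lemma representative_unique:
  assumes "s \<in> {1..n}" "s' \<in> {1..n}" "[int s = int s'] (mod int n)"
  shows "s = s'"
proof -
  have "int n dvd int s - int s'"
    using assms(3) by (simp add: cong_iff_dvd_diff)
  moreover have "\<bar>int s - int s'\<bar> < int n"
    using assms(1,2) by auto
  ultimately show ?thesis
    using dvd_imp_le_int[of "int s - int s'" "int n"] by fastforce
qed

lemma representative_exists:
  assumes "0 < n"
  shows "\<exists>s \<in> {1..n}. [int s = z] (mod int n)"
proof
  \<comment> \<open>The shift by one moves the residues \<open>0..<n\<close> to the representatives \<open>1..n\<close>.\<close>
  let ?r = "(z - 1) mod int n"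
  have r: "0 \<le> ?r" "?r < int n"
    using assms by auto
  then show "nat (?r + 1) \<in> {1..n}"
    by auto
  have "[?r + 1 = (z - 1) + 1] (mod int n)"
    by (intro cong_add) auto
  then show "[int (nat (?r + 1)) = z] (mod int n)"
    using r by simp
qed

lemma point_mult_unique:
  assumes "s \<in> {1..n}" "[int s = int m * int b - (int m - 1) * int a] (mod int n)"
  shows "point_mult n m a b = s"
  unfolding point_mult_def
proof (rule the_equality)
  show "s' = s" if "s' \<in> {1..n} \<and> [int s' = int m * int b - (int m - 1) * int a] (mod int n)" for s'
    using that assms by (meson cong_sym cong_trans representative_unique)
qed (use assms in simp)

lemma point_mult:
  assumes "0 < n"
  shows "point_mult n m a b \<in> {1..n}"
    and "[int (point_mult n m a b) = int m * int b - (int m - 1) * int a] (mod int n)"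
proof -
  obtain s where s: "s \<in> {1..n}" "[int s = int m * int b - (int m - 1) * int a] (mod int n)"
    using representative_exists[OF assms] by blast
  with point_mult_unique[OF s]
  show "point_mult n m a b \<in> {1..n}"
    and "[int (point_mult n m a b) = int m * int b - (int m - 1) * int a] (mod int n)"
    by simp_all
qed

text \<open>
  The coefficients \<open>m\<close> and \<open>1 - m\<close> add up to 1, so the product stays in the common residue
  class of its factors modulo any divisor of \<open>n\<close>.
\<close>

lemma point_mult_residue_class:
  assumes "0 < n" "t dvd n" "[a = c] (mod t)" "[b = c] (mod t)"
  shows "[point_mult n m a b = c] (mod t)"
proof -
  have "[int (point_mult n m a b) = int m * int b - (int m - 1) * int a] (mod int t)"
    using point_mult(2)[OF assms(1)] assms(2) by (meson cong_dvd_modulus of_nat_dvd_iff)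
  also have "[int m * int b - (int m - 1) * int a = int m * int c - (int m - 1) * int c] (mod int t)"
    using assms(3,4) by (intro cong_diff cong_mult cong_refl) (simp_all add: cong_int_iff)
  also have "int m * int c - (int m - 1) * int c = int c"
    by (simp add: algebra_simps)
  finally show ?thesis
    by (simp add: cong_int_iff)
qed

text \<open>
  Translation invariance. The difference \<open>j - i\<close> may be negative, so the translate of a point
  \<open>s\<close> by it is expressed through the equation \<open>s + j = s' + i\<close>.
\<close>

lemma point_mult_translate:
  assumes "0 < n" "s \<in> {1..n}"
    and "a + j = a' + i" "b + j = b' + i" "point_mult n m a b + j = s + i"
  shows "point_mult n m a' b' = s"
proof (rule point_mult_unique[OF assms(2)])
  have a': "int a' = int a + (int j - int i)" and b': "int b' = int b + (int j - int i)"
    and s: "int s = int (point_mult n m a b) + (int j - int i)"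
    using assms(3-5) by linarith+
  have "[int s = int m * int b - (int m - 1) * int a + (int j - int i)] (mod int n)"
    unfolding s by (intro cong_add point_mult(2) assms(1) cong_refl)
  also have "int m * int b - (int m - 1) * int a + (int j - int i)
      = int m * int b' - (int m - 1) * int a'"
    unfolding a' b' by (simp add: algebra_simps)
  finally show "[int s = int m * int b' - (int m - 1) * int a'] (mod int n)" .
qed


section \<open>The subloops of points in a residue class\<close>

lemma Pt_in_H_iff:
  assumes "0 < n" "0 < t" "t dvd n" "i \<in> {1..t}"
  shows "Pt s \<in> H n t i \<longleftrightarrow> s \<in> {1..n} \<and> [s = i] (mod t)"
proof
  assume "Pt s \<in> H n t i"
  then obtain r where r: "r < n div t" "s = i + r * t"
    by (auto simp: H_def)
  have "Suc r * t \<le> n div t * t"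
    using r(1) by (intro mult_right_mono) auto
  then have "s \<le> n"
    using assms r by auto
  then show "s \<in> {1..n} \<and> [s = i] (mod t)"
    using assms r by (auto simp: cong_def)
next
  assume s: "s \<in> {1..n} \<and> [s = i] (mod t)"
  have "i \<le> s"
  proof (rule ccontr)
    \<comment> \<open>Both numbers lie in \<open>{1..t}\<close>, where residues modulo \<open>t\<close> are represented uniquely.\<close>
    assume "\<not> i \<le> s"
    then have "s \<in> {1..t}"
      using s assms by auto
    then have "s = i"
      using s assms representative_unique[of s t i] by (auto simp: cong_int_iff)
    then show False
      using \<open>\<not> i \<le> s\<close> by simp
  qed
  from cong_le_nat[OF this] s obtain r where "s = r * t + i"
    by blast
  then have r: "s = i + r * t"
    by simp
  have "r * t < n"
    using s[THEN conjunct1] assms(4) unfolding r by simp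
  also have "n = n div t * t"
    using assms(3) by simp
  finally have "r * t < n div t * t" .
  then have "r < n div t"
    by simp
  then show "Pt s \<in> H n t i"
    using r by (auto simp: H_def)
qed

lemma L_simps:
  "carrier (L n m) = insert Ident (Pt ` {1..n})" "x \<otimes>\<^bsub>L n m\<^esub> y = L_mult n m x y"
  "\<one>\<^bsub>L n m\<^esub> = Ident"
  by (simp_all add: L_def)

lemma L_mult_Ident_right: "L_mult n m x Ident = x"
  by (cases x) simp_all

lemma cong_scaled_difference_cancel:
  fixes c u v w :: int
  assumes "[c * u - w = c * v - w] (mod k)" "coprime c k"
  shows "[u = v] (mod k)"
proof -
  have "[c * u = c * v] (mod k)"
    using cong_add[OF assms(1) cong_refl[of w]] by simp
  then show ?thesis
    using cong_mult_lcancel[OF assms(2)] by simp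
qed

locale L_loop =
  fixes n m :: nat
  assumes n_pos: "0 < n" and m_pos: "0 < m"
    and coprime_m: "coprime m n" and coprime_m1: "coprime (m - 1) n"
begin

lemma coprime_int_m: "coprime (int m) (int n)"
  using coprime_m by simp

lemma coprime_int_m1: "coprime (int m - 1) (int n)"
proof -
  have "int m - 1 = int (m - 1)"
    using m_pos by simp
  then show ?thesis
    using coprime_m1 by (metis coprime_int_iff)
qed

lemma point_mult_left_cancel:
  assumes "b \<in> {1..n}" "b' \<in> {1..n}" "point_mult n m a b = point_mult n m a b'"
  shows "b = b'"
proof -
  have "[int m * int b - (int m - 1) * int a = int m * int b' - (int m - 1) * int a] (mod int n)"
    using point_mult(2)[OF n_pos] assms(3) by (metis cong_sym cong_trans)
  from cong_scaled_difference_cancel[OF this coprime_int_m] show ?thesis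
    using assms representative_unique by blast
qed

lemma point_mult_right_cancel:
  assumes "a \<in> {1..n}" "a' \<in> {1..n}" "point_mult n m a b = point_mult n m a' b"
  shows "a = a'"
proof -
  have "[int m * int b - (int m - 1) * int a = int m * int b - (int m - 1) * int a'] (mod int n)"
    using point_mult(2)[OF n_pos] assms(3) by (metis cong_sym cong_trans)
  then have "[(int m - 1) * int a - int m * int b = (int m - 1) * int a' - int m * int b] (mod int n)"
    using cong_minus_minus_iff minus_diff_eq by metis
  from cong_scaled_difference_cancel[OF this coprime_int_m1] show ?thesis
    using assms representative_unique by blast
qed

lemma point_mult_self: "a \<in> {1..n} \<Longrightarrow> point_mult n m a a = a"
  by (rule point_mult_unique) (simp_all add: algebra_simps)

text \<open>
  The operation on points alone is an idempotent quasigroup. Hence a product of distinct points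
  differs from both factors, so replacing the squares by the identity and multiplying by the
  identity introduce no collision.
\<close>

lemma L_mult_left_cancel:
  assumes "a \<in> carrier (L n m)" "x \<in> carrier (L n m)" "y \<in> carrier (L n m)"
    and "L_mult n m a x = L_mult n m a y"
  shows "x = y"
proof (cases a)
  case Ident
  then show ?thesis using assms by simp
next
  case (Pt p)
  then have p: "p \<in> {1..n}"
    using assms by (auto simp: L_simps)
  have neq: "point_mult n m p q \<noteq> p" if "q \<in> {1..n}" "p \<noteq> q" for q
    using point_mult_left_cancel[of q p p] point_mult_self[OF p] that p by auto
  then show ?thesis
    using assms(2-4)
    by (cases x; cases y)
      (auto simp: Pt L_simps L_mult_Pt neq neq[symmetric]
        simp del: L_mult.simps(3) atLeastAtMost_iff One_nat_def
        split: if_splits dest: point_mult_left_cancel)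
qed

lemma L_mult_right_cancel:
  assumes "a \<in> carrier (L n m)" "x \<in> carrier (L n m)" "y \<in> carrier (L n m)"
    and "L_mult n m x a = L_mult n m y a"
  shows "x = y"
proof (cases a)
  case Ident
  then show ?thesis using assms by (simp add: L_mult_Ident_right)
next
  case (Pt p)
  then have p: "p \<in> {1..n}"
    using assms by (auto simp: L_simps)
  have neq: "point_mult n m q p \<noteq> p" if "q \<in> {1..n}" "p \<noteq> q" for q
    using point_mult_right_cancel[of q p p] point_mult_self[OF p] that p by auto
  then show ?thesis
    using assms(2-4)
    by (cases x; cases y)
      (auto simp: Pt L_simps L_mult_Pt neq neq[symmetric]
        simp del: L_mult.simps(3) atLeastAtMost_iff One_nat_def
        split: if_splits dest: point_mult_right_cancel)
qed

lemma H_subset: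
  assumes "0 < t" "t dvd n" "i \<in> {1..t}"
  shows "H n t i \<subseteq> carrier (L n m)"
proof
  fix x assume "x \<in> H n t i"
  then show "x \<in> carrier (L n m)"
    using Pt_in_H_iff[OF n_pos assms] by (cases x) (auto simp: L_simps)
qed

lemma point_mult_in_H:
  assumes "0 < t" "t dvd n" "i \<in> {1..t}" "Pt a \<in> H n t i" "Pt b \<in> H n t i"
  shows "Pt (point_mult n m a b) \<in> H n t i"
  using assms(4,5) point_mult(1)[OF n_pos] point_mult_residue_class[OF n_pos assms(2), of a i b]
  unfolding Pt_in_H_iff[OF n_pos assms(1-3)] by blast

lemma Ident_in_H: "Ident \<in> H n t i"
  by (simp add: H_def)

lemma H_loop:
  assumes "0 < t" "t dvd n" "i \<in> {1..t}"
  shows "loop ((L n m)\<lparr>carrier := H n t i\<rparr>)"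
proof (rule finite_cancellative_loop)
  let ?G = "(L n m)\<lparr>carrier := H n t i\<rparr>"
  show "finite (carrier ?G)"
    by (simp add: H_def)
  show "\<one>\<^bsub>?G\<^esub> \<in> carrier ?G"
    by (simp add: L_simps Ident_in_H)
  show "x \<otimes>\<^bsub>?G\<^esub> y \<in> carrier ?G" if "x \<in> carrier ?G" "y \<in> carrier ?G" for x y
    using that point_mult_in_H[OF assms] Ident_in_H
    by (cases x; cases y) (auto simp: L_simps L_mult_Pt simp del: L_mult.simps(3))
  show "\<one>\<^bsub>?G\<^esub> \<otimes>\<^bsub>?G\<^esub> x = x" "x \<otimes>\<^bsub>?G\<^esub> \<one>\<^bsub>?G\<^esub> = x" for x
    by (simp_all add: L_simps L_mult_Ident_right)
  fix a assume "a \<in> carrier ?G"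
  then have a: "a \<in> carrier (L n m)"
    using H_subset[OF assms] by auto
  have "inj_on (\<lambda>x. L_mult n m a x) (H n t i)" "inj_on (\<lambda>x. L_mult n m x a) (H n t i)"
    using L_mult_left_cancel[OF a] L_mult_right_cancel[OF a] H_subset[OF assms]
    by (blast intro: inj_onI)+
  then show "inj_on (\<lambda>x. a \<otimes>\<^bsub>?G\<^esub> x) (carrier ?G)" "inj_on (\<lambda>x. x \<otimes>\<^bsub>?G\<^esub> a) (carrier ?G)"
    by (simp_all add: L_simps)
qed

lemma H_neutrosophic_subloop:
  assumes "0 < t" "t dvd n" "i \<in> {1..t}"
  shows "neutrosophic_subloop (adjoin_I (H n t i)) (L n m)"
  using H_subset[OF assms] H_loop[OF assms] unfolding neutrosophic_subloop_def by blast

end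


section \<open>Translations between residue classes\<close>

text \<open>
  This is the translation by \<open>j - i\<close>; the subtraction is exact on points \<open>s \<ge> i\<close>, in
  particular on \<^term>\<open>H n t i\<close>.
\<close>

fun shift :: "nat \<Rightarrow> nat \<Rightarrow> loop_elem \<Rightarrow> loop_elem" where
  "shift i j Ident = Ident"
| "shift i j (Pt s) = Pt (s + j - i)"

lemma shift_image_H: "shift i j ` H n t i = H n t j"
  by (force simp: H_def image_image)

lemma shift_inj_on_H: "inj_on (shift i j) (H n t i)"
  by (auto simp: inj_on_def H_def)

lemma H_point_ge: "Pt s \<in> H n t i \<Longrightarrow> i \<le> s"
  by (auto simp: H_def)

context L_loop
begin

lemma shift_iso:
  assumes "0 < t" "t dvd n" "i \<in> {1..t}" "j \<in> {1..t}"
  shows "shift i j \<in> iso ((L n m)\<lparr>carrier := H n t i\<rparr>) ((L n m)\<lparr>carrier := H n t j\<rparr>)"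
proof -
  have "shift i j (L_mult n m x y) = L_mult n m (shift i j x) (shift i j y)"
    if x: "x \<in> H n t i" and y: "y \<in> H n t i" for x y
  proof (cases "x = Ident \<or> y = Ident \<or> x = y")
    case True
    then show ?thesis
      by (cases x; cases y) auto
  next
    case False
    then obtain a b where ab: "x = Pt a" "y = Pt b" "a \<noteq> b"
      by (metis loop_elem.exhaust)
    let ?s = "point_mult n m a b"
    have s: "Pt ?s \<in> H n t i"
      using point_mult_in_H[OF assms(1-3)] x y ab by simp
    have ge: "i \<le> a" "i \<le> b" "i \<le> ?s"
      using x y s ab H_point_ge by auto
    have "Pt (?s + j - i) \<in> H n t j"
      using s shift_image_H[of i j n t] by (metis image_eqI shift.simps(2))
    then have range: "?s + j - i \<in> {1..n}"
      using Pt_in_H_iff[OF n_pos assms(1,2,4)] by simp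
    have "point_mult n m (a + j - i) (b + j - i) = ?s + j - i"
      by (rule point_mult_translate[OF n_pos range, where a = a and b = b and i = i and j = j]) (use ge in auto)
    moreover have "a + j - i \<noteq> b + j - i"
      using ge ab by auto
    ultimately show ?thesis
      using ab by (simp add: L_mult_Pt del: L_mult.simps(3))
  qed
  then show ?thesis
    using shift_image_H[of i j n t] shift_inj_on_H[of i j n t]
    by (auto simp: iso_def hom_def bij_betw_def L_simps)
qed

end

theorem corollary4p1p3:
  fixes n m t i j :: nat
  assumes "n > 3" and "odd n"
    and "0 < m" and "m < n"
    and "gcd m n = 1" and "gcd (m - 1) n = 1"
    and "0 < t" and "t dvd n"
    and "i \<in> {1..t}" and "j \<in> {1..t}"
  shows "neutrosophic_subloop (adjoin_I (H n t i)) (L n m)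
    \<and> neutrosophic_subloop (adjoin_I (H n t j)) (L n m)
    \<and> (\<exists>f. f \<in> neutrosophic_iso
          ((neutrosophic_loop (L n m))\<lparr>carrier := adjoin_I (H n t i)\<rparr>)
          ((neutrosophic_loop (L n m))\<lparr>carrier := adjoin_I (H n t j)\<rparr>))"
proof -
  interpret L_loop n m
    by unfold_locales (use assms(1,3,5,6) in \<open>auto simp: coprime_iff_gcd_eq_1\<close>)
  show ?thesis
    using H_neutrosophic_subloop[OF assms(7,8)] assms(9,10)
      map_neutro_neutrosophic_iso[OF shift_iso[OF assms(7-10)]]
    unfolding neutrosophic_loop_carrier_update by blast
qed

end
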